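(* For every integer $m\ge 0$, the exponential polynomials satisfy $$\sum_{n=0}^{\infty}\phi_{n+m}(x)\frac{t^{n}}{n!}=e^{x(e^{t}-1)}\,\phi_{m}(xe^{t}),\qquad t\in\mathbb{C}.$$
   Context: The exponential polynomials are $\phi_n(x)=\sum_{k=0}^{n}\genfrac{\{}{\}}{0pt}{}{n}{k}x^k$, where $\genfrac{\{}{\}}{0pt}{}{n}{k}$ are the Stirling numbers of the second kind; $x$ is a complex variable. *)

theory Defs
  imports "HOL-Analysis.Analysis" "HOL-Combinatorics.Stirling"
begin

definition exp_poly :: "nat \<Rightarrow> complex \<Rightarrow> complex" where
  "exp_poly n x = (\<Sum>k=0..n. of_nat (Stirling n k) * x ^ k)"

end

theory Submission
  imports Defs "HOL-Complex_Analysis.Cauchy_Integral_Formula"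
begin

text \<open>The functions \<open>t \<mapsto> e\<^bsup>x(e\<^sup>t - 1)\<^esup> \<phi>\<^sub>m(x e\<^sup>t)\<close> are entire, and by the Stirling recurrence, in the form
  \<open>\<phi>\<^sub>m\<^sub>+\<^sub>1(y) = y (\<phi>\<^sub>m(y) + \<phi>\<^sub>m'(y))\<close>, each is the derivative of its predecessor. The claimed series is therefore
  the Taylor series of the \<open>m\<close>-th function at \<open>0\<close>.\<close>

text \<open>The truncated exponent \<open>k - 1\<close> is harmless at \<open>k = 0\<close>, where
  the factor \<open>of_nat k\<close> is zero.\<close>

definition exp_poly_deriv :: "nat \<Rightarrow> complex \<Rightarrow> complex" where
  "exp_poly_deriv n y = (\<Sum>k=0..n. of_nat (Stirling n k) * (of_nat k * y ^ (k - 1)))"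

lemma exp_poly_has_field_derivative:
  "(exp_poly n has_field_derivative exp_poly_deriv n y) (at y)"
  unfolding exp_poly_def [abs_def] exp_poly_deriv_def
  by (auto intro!: derivative_eq_intros sum.cong)

lemma exp_poly_Suc:
  "exp_poly (Suc n) y = y * (exp_poly n y + exp_poly_deriv n y)"
proof -
  \<comment> \<open>The term \<open>k = 0\<close> drops out since
    \<open>Stirling (Suc n) 0 = 0\<close>.\<close>
  have "exp_poly (Suc n) y = (\<Sum>k=0..n. of_nat (Stirling (Suc n) (Suc k)) * y ^ Suc k)"
    unfolding exp_poly_def by (subst sum.atLeast0_atMost_Suc_shift) simp
  also have "\<dots> = (\<Sum>k=0..n. of_nat (Stirling n k) * y ^ Suc k)
      + (\<Sum>k=0..n. of_nat (Stirling n (Suc k)) * (of_nat (Suc k) * y ^ Suc k))"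
    by (simp add: sum.distrib [symmetric] algebra_simps)
  also have "(\<Sum>k=0..n. of_nat (Stirling n k) * y ^ Suc k) = y * exp_poly n y"
    by (simp add: exp_poly_def sum_distrib_left mult_ac)
  also have "(\<Sum>k=0..n. of_nat (Stirling n (Suc k)) * (of_nat (Suc k) * y ^ Suc k))
      = (\<Sum>k=0..Suc n. of_nat (Stirling n k) * (of_nat k * y ^ k))"
    by (subst sum.atLeast0_atMost_Suc_shift) simp
  \<comment> \<open>The top term vanishes: \<open>Stirling n (Suc n) = 0\<close>.\<close>
  also have "\<dots> = (\<Sum>k=0..n. of_nat (Stirling n k) * (of_nat k * y ^ k))"
    by simp
  also have "\<dots> = y * exp_poly_deriv n y"
    unfolding exp_poly_deriv_def sum_distrib_left
    by (intro sum.cong refl) (simp add: power_eq_if)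
  finally show ?thesis
    by (simp add: distrib_left)
qed

definition exp_poly_egf :: "nat \<Rightarrow> complex \<Rightarrow> complex \<Rightarrow> complex" where
  "exp_poly_egf m x t = exp (x * (exp t - 1)) * exp_poly m (x * exp t)"

text \<open>With \<open>y = x * exp t\<close>, both \<open>y\<close> and the exponent
  \<open>x * (exp t - 1)\<close> have derivative \<open>y\<close> in \<open>t\<close>, so the
  product rule yields the factor \<open>y * (exp_poly m y + exp_poly_deriv m y)\<close>.\<close>

lemma exp_poly_egf_has_field_derivative:
  "(exp_poly_egf m x has_field_derivative exp_poly_egf (Suc m) x t) (at t)"
  unfolding exp_poly_egf_def [abs_def]
  by (auto intro!: derivative_eq_intros DERIV_chain2 [OF exp_poly_has_field_derivative]
      simp: exp_poly_Suc algebra_simps)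

lemma higher_deriv_exp_poly_egf:
  "(deriv ^^ n) (exp_poly_egf m x) = exp_poly_egf (n + m) x"
  by (induction n) (auto intro!: DERIV_imp_deriv exp_poly_egf_has_field_derivative)

theorem corollary4:
  fixes m :: nat and x t :: complex
  shows "(\<lambda>n. exp_poly (n + m) x * (t ^ n / fact n)) sums
           (exp (x * (exp t - 1)) * exp_poly m (x * exp t))"
proof -
  have "exp_poly_egf m x holomorphic_on ball 0 (norm t + 1)"
    using exp_poly_egf_has_field_derivative
    by (meson holomorphic_on_open open_ball)
  moreover have "t \<in> ball 0 (norm t + 1)"
    by simp
  ultimately have "(\<lambda>n. (deriv ^^ n) (exp_poly_egf m x) 0 / fact n * (t - 0) ^ n)
      sums exp_poly_egf m x t"
    by (rule holomorphic_power_series)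
  \<comment> \<open>At 0 the exponential factor is 1 and \<open>x * exp 0 = x\<close>, so the
    derivatives there are \<open>exp_poly (n + m) x\<close>.\<close>
  then show ?thesis
    by (simp add: higher_deriv_exp_poly_egf exp_poly_egf_def)
qed

end
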